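(* For every integer $r\ge1$ there is a constant $C_r>0$ depending only on $r$ such that for every integer $n>r$ and every $\theta\in\mathbb{R}^n$ there exists $\theta'\in\mathbb{R}^n$ which is a polynomial vector of degree at most $r-1$ with $$\|\theta-\theta'\|_\infty\le C_r\,n^{r-1}\|D^{(r)}(\theta)\|_1=C_r\,V^{(r)}(\theta).$$
   Context: For $\theta\in\mathbb{R}^n$, $D^{(0)}(\theta)=\theta$, $D^{(1)}(\theta)=(\theta_2-\theta_1,\dots,\theta_n-\theta_{n-1})$, $D^{(r)}(\theta)=D^{(1)}(D^{(r-1)}(\theta))\in\mathbb{R}^{n-r}$, and $V^{(r)}(\theta)=n^{r-1}\|D^{(r)}(\theta)\|_1$. A vector $\theta'\in\mathbb{R}^n$ is a polynomial vector of degree at most $q$ if there is a univariate polynomial $f$ of degree at most $q$ with $\theta'_i=f(i/n)$ for all $i=1,\dots,n$. *)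

theory Defs
  imports Complex_Main "HOL-Computational_Algebra.Polynomial" "Jordan_Normal_Form.Matrix"
begin

text \<open>
  Since the dimension $n$ is quantified inside the statement, \<open>\<real>\<^sup>n\<close> is \<^term>\<open>carrier_vec n :: real vec set\<close>.
  Vectors of this type are indexed from 0: the mathematical entry $\theta_i$ ($1 \le i \le n$)
  is \<open>\<theta> $ (i - 1)\<close>.
\<close>

definition diff1 :: "real vec \<Rightarrow> real vec" where
  "diff1 \<theta> = vec (dim_vec \<theta> - 1) (\<lambda>i. \<theta> $ (i + 1) - \<theta> $ i)"

primrec iterated_diff :: "nat \<Rightarrow> real vec \<Rightarrow> real vec" where
  "iterated_diff 0 \<theta> = \<theta>"
| "iterated_diff (Suc r) \<theta> = diff1 (iterated_diff r \<theta>)"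

definition l1_norm :: "real vec \<Rightarrow> real" where
  "l1_norm v = (\<Sum>i<dim_vec v. \<bar>v $ i\<bar>)"

text \<open>Inserting 0 only matters in dimension 0, where \<^const>\<open>Max\<close> of the empty set is unspecified.\<close>

definition linf_norm :: "real vec \<Rightarrow> real" where
  "linf_norm v = Max (insert 0 ((\<lambda>i. \<bar>v $ i\<bar>) ` {..<dim_vec v}))"

text \<open>The exponent is an integer, so that $r = 0$ gives $n^{-1}$.\<close>

definition variation :: "nat \<Rightarrow> real vec \<Rightarrow> real" where
  "variation r \<theta> = real (dim_vec \<theta>) powi (int r - 1) * l1_norm (iterated_diff r \<theta>)"

definition polynomial_vector :: "nat \<Rightarrow> real vec \<Rightarrow> bool" where
  "polynomial_vector q v \<longleftrightarrow>
     (\<exists>f :: real poly. degree f \<le> q \<and>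
        (\<forall>i\<in>{1..dim_vec v}. v $ (i - 1) = poly f (real i / real (dim_vec v))))"

end

theory Submission
  imports Defs
begin

text \<open>
  Take the degree \<open>r - 1\<close> Newton interpolation of \<open>\<theta>\<close> at the left end of the grid, written in the
  binomial basis. It is built by induction on \<open>r\<close>: an approximation of the difference vector is
  summed up from the left end with the correct starting value, so that an entrywise error
  \<open>\<epsilon>\<close> for the differences becomes an error at most \<open>n \<epsilon>\<close>. Each step thus costs one factor \<open>n\<close>,
  and \<open>C\<^sub>r = 1\<close> works.
\<close>

text \<open>The definition adds each new difference outermost; the induction in
  \<open>newton_approximation\<close> needs it innermost, so that the hypothesis can be applied to
  \<open>diff1 \<theta>\<close>.\<close>

lemma iterated_diff_Suc_diff1: "iterated_diff (Suc r) \<theta> = iterated_diff r (diff1 \<theta>)"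
  by (induction r) auto

lemma l1_norm_nonneg: "0 \<le> l1_norm v"
  by (simp add: l1_norm_def sum_nonneg)

text \<open>The assumption \<open>0 \<le> B\<close> covers the 0 inserted in
  \<open>linf_norm\<close>, which is the whole set in dimension 0.\<close>

lemma linf_norm_le:
  assumes "\<And>i. i < dim_vec v \<Longrightarrow> \<bar>v $ i\<bar> \<le> B" and "0 \<le> B"
  shows "linf_norm v \<le> B"
  using assms by (auto simp: linf_norm_def)

lemma vec_index_eq_sum_diff1:
  assumes "i < dim_vec \<theta>"
  shows "\<theta> $ i = \<theta> $ 0 + (\<Sum>j<i. diff1 \<theta> $ j)"
  using assms by (induction i) (auto simp: diff1_def)

text \<open>The hockey-stick identity, from Pascal's rule.\<close>

lemma sum_choose_lessThan: "(\<Sum>j<i. j choose k) = i choose Suc k"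
  by (induction i) auto

text \<open>In the binomial basis, summation only shifts the index of each coefficient by one. This
  leaves the constant term free for a starting value.\<close>

lemma sum_newton_lessThan:
  fixes c :: "nat \<Rightarrow> real"
  shows "(\<Sum>j<i. \<Sum>k\<le>r. c k * real (j choose k)) = (\<Sum>k\<le>r. c k * real (i choose Suc k))"
proof -
  have "(\<Sum>j<i. \<Sum>k\<le>r. c k * real (j choose k)) = (\<Sum>k\<le>r. c k * (\<Sum>j<i. real (j choose k)))"
    by (subst sum.swap) (simp add: sum_distrib_left)
  then show ?thesis
    by (simp flip: of_nat_sum add: sum_choose_lessThan)
qed

lemma newton_approximation:
  "\<exists>c :: nat \<Rightarrow> real. \<forall>i<dim_vec \<theta>.
     \<bar>\<theta> $ i - (\<Sum>k\<le>r. c k * real (i choose k))\<bar>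
       \<le> real (dim_vec \<theta>) ^ r * l1_norm (iterated_diff (Suc r) \<theta>)"
proof (induction r arbitrary: \<theta>)
  case 0
  have "\<bar>\<theta> $ i - \<theta> $ 0\<bar> \<le> l1_norm (diff1 \<theta>)" if i: "i < dim_vec \<theta>" for i
  proof -
    have "\<bar>\<theta> $ i - \<theta> $ 0\<bar> \<le> (\<Sum>j<i. \<bar>diff1 \<theta> $ j\<bar>)"
      using vec_index_eq_sum_diff1[OF i] by simp
    also have "\<dots> \<le> l1_norm (diff1 \<theta>)"
      unfolding l1_norm_def using i by (intro sum_mono2) (auto simp: diff1_def)
    finally show ?thesis .
  qed
  then show ?case
    by (intro exI[of _ "\<lambda>_. \<theta> $ 0"]) simp
next
  case (Suc r)
  let ?n = "dim_vec \<theta>" and ?L = "l1_norm (iterated_diff (Suc (Suc r)) \<theta>)"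
  have dim: "dim_vec (diff1 \<theta>) = ?n - 1"
    by (simp add: diff1_def)
  obtain c :: "nat \<Rightarrow> real" where c: "\<And>j. j < ?n - 1 \<Longrightarrow>
      \<bar>diff1 \<theta> $ j - (\<Sum>k\<le>r. c k * real (j choose k))\<bar> \<le> real (?n - 1) ^ r * ?L"
    using Suc.IH[of "diff1 \<theta>"] unfolding dim iterated_diff_Suc_diff1[of "Suc r" \<theta>] by blast
  \<comment> \<open>The starting value enters as coefficient 0, and the old coefficients move up by
    one.\<close>
  define d where "d k = (case k of 0 \<Rightarrow> \<theta> $ 0 | Suc k \<Rightarrow> c k)" for k
  have "\<bar>\<theta> $ i - (\<Sum>k\<le>Suc r. d k * real (i choose k))\<bar> \<le> real ?n ^ Suc r * ?L"
    if i: "i < ?n" for i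
  proof -
    have "(\<Sum>k\<le>Suc r. d k * real (i choose k))
        = \<theta> $ 0 + (\<Sum>j<i. \<Sum>k\<le>r. c k * real (j choose k))"
      by (simp add: sum.atMost_Suc_shift sum_newton_lessThan d_def del: sum.atMost_Suc)
    then have "\<bar>\<theta> $ i - (\<Sum>k\<le>Suc r. d k * real (i choose k))\<bar>
        = \<bar>\<Sum>j<i. diff1 \<theta> $ j - (\<Sum>k\<le>r. c k * real (j choose k))\<bar>"
      using vec_index_eq_sum_diff1[OF i] by (simp add: sum_subtractf)
    \<comment> \<open>From \<open>j < i\<close> and \<open>i < ?n\<close> follows
      \<open>j < ?n - 1\<close>, so \<open>c\<close> applies to every summand.\<close>
    also have "\<dots> \<le> (\<Sum>j<i. real (?n - 1) ^ r * ?L)"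
      using i by (intro order.trans[OF sum_abs] sum_mono c) auto
    also have "\<dots> = real i * (real (?n - 1) ^ r * ?L)"
      by simp
    \<comment> \<open>The number \<open>i\<close> of summands is at most \<open>?n\<close>: this is
      the one factor lost per step.\<close>
    also have "\<dots> \<le> real ?n * (real ?n ^ r * ?L)"
      using i by (intro mult_mono power_mono mult_nonneg_nonneg l1_norm_nonneg) auto
    finally show ?thesis
      by (simp add: mult.assoc)
  qed
  then show ?case
    by blast
qed

lemma choose_eq_poly: "\<exists>p :: real poly. degree p \<le> k \<and> (\<forall>i. poly p (real i) = real (i choose k))"
proof (intro exI conjI allI)
  \<comment> \<open>The falling factorial x(x-1)...(x-k+1) divided by k!, a product of k linear
    factors.\<close>
  let ?p = "Polynomial.smult (1 / fact k) (\<Prod>j<k. [:- real j, 1:])"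
  show "degree ?p \<le> k"
    using degree_prod_sum_le[of "{..<k}" "\<lambda>j. [:- real j, 1:]"] by simp
  show "poly ?p (real i) = real (i choose k)" for i
    by (simp add: poly_prod binomial_gbinomial gbinomial_prod_rev atLeast0LessThan)
qed

lemma newton_eq_poly:
  fixes c :: "nat \<Rightarrow> real"
  shows "\<exists>p. degree p \<le> r \<and> (\<forall>i. poly p (real i) = (\<Sum>k\<le>r. c k * real (i choose k)))"
proof -
  obtain b :: "nat \<Rightarrow> real poly"
    where b: "\<And>k. degree (b k) \<le> k" "\<And>k i. poly (b k) (real i) = real (i choose k)"
    using choose_eq_poly by metis
  let ?p = "\<Sum>k\<le>r. Polynomial.smult (c k) (b k)"
  have "degree ?p \<le> r"
    by (intro degree_sum_le) (auto intro: order.trans[OF degree_smult_le] order.trans[OF b(1)])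
  moreover have "poly ?p (real i) = (\<Sum>k\<le>r. c k * real (i choose k))" for i
    by (simp add: poly_sum b(2))
  ultimately show ?thesis
    by blast
qed

lemma polynomial_vector_of_poly:
  assumes "degree p \<le> q"
  shows "polynomial_vector q (vec n (\<lambda>i. poly p (real i)))"
  unfolding polynomial_vector_def
proof (intro exI conjI ballI)
  \<comment> \<open>The substitution n x - 1 sends the grid point i/n to i - 1, the index counted
    from 0. Being of degree at most 1, it does not raise the degree.\<close>
  let ?f = "pcompose p [:-1, real n:]"
  show "degree ?f \<le> q"
    using assms by (auto simp: degree_pcompose intro: order.trans)
  show "vec n (\<lambda>i. poly p (real i)) $ (i - 1)
      = poly ?f (real i / real (dim_vec (vec n (\<lambda>i. poly p (real i)))))"
    if "i \<in> {1..dim_vec (vec n (\<lambda>i. poly p (real i)))}" for i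
    using that by (auto simp: poly_pcompose of_nat_diff)
qed

lemma polynomial_approximation:
  assumes "\<theta> \<in> carrier_vec n"
  shows "\<exists>\<theta>'\<in>carrier_vec n. polynomial_vector r \<theta>' \<and>
    linf_norm (\<theta> - \<theta>') \<le> real n ^ r * l1_norm (iterated_diff (Suc r) \<theta>)"
proof -
  have n: "dim_vec \<theta> = n"
    using assms by simp
  obtain c where c: "\<And>i. i < n \<Longrightarrow> \<bar>\<theta> $ i - (\<Sum>k\<le>r. c k * real (i choose k))\<bar>
      \<le> real n ^ r * l1_norm (iterated_diff (Suc r) \<theta>)"
    using newton_approximation[of \<theta> r] unfolding n by blast
  obtain p where p: "degree p \<le> r" "\<And>i. poly p (real i) = (\<Sum>k\<le>r. c k * real (i choose k))"
    using newton_eq_poly[of r c] by blast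
  show ?thesis
  proof (intro bexI conjI)
    show "polynomial_vector r (vec n (\<lambda>i. poly p (real i)))"
      by (rule polynomial_vector_of_poly) (rule p(1))
    show "linf_norm (\<theta> - vec n (\<lambda>i. poly p (real i)))
        \<le> real n ^ r * l1_norm (iterated_diff (Suc r) \<theta>)"
      using c by (intro linf_norm_le) (auto simp: p(2) l1_norm_nonneg simp del: iterated_diff.simps)
  qed simp
qed

text \<open>For positive order the integer exponent is a natural number, and \<open>powi\<close>
  becomes an ordinary power.\<close>

lemma variation_Suc:
  "variation (Suc r) \<theta> = real (dim_vec \<theta>) ^ r * l1_norm (iterated_diff (Suc r) \<theta>)"
  by (simp add: variation_def)

theorem lemma8p10:
  shows "\<forall>r::nat. r \<ge> 1 \<longrightarrow>
    (\<exists>C::real. C > 0 \<and>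
      (\<forall>n::nat. n > r \<longrightarrow>
        (\<forall>\<theta>\<in>carrier_vec n. \<exists>\<theta>'\<in>carrier_vec n.
           polynomial_vector (r - 1) \<theta>' \<and>
           linf_norm (\<theta> - \<theta>') \<le> C * real n ^ (r - 1) * l1_norm (iterated_diff r \<theta>) \<and>
           C * real n ^ (r - 1) * l1_norm (iterated_diff r \<theta>) = C * variation r \<theta>)))"
proof (intro allI impI)
  fix r :: nat
  assume "r \<ge> 1"
  then obtain q where r: "r = Suc q"
    by (cases r) auto
  have "\<exists>\<theta>'\<in>carrier_vec n. polynomial_vector (r - 1) \<theta>' \<and>
      linf_norm (\<theta> - \<theta>') \<le> 1 * real n ^ (r - 1) * l1_norm (iterated_diff r \<theta>) \<and>
      1 * real n ^ (r - 1) * l1_norm (iterated_diff r \<theta>) = 1 * variation r \<theta>"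
    if "\<theta> \<in> carrier_vec n" for n \<theta>
    using polynomial_approximation[OF that, of q] that
    by (simp add: r variation_Suc del: iterated_diff.simps)
  then show "\<exists>C::real. C > 0 \<and>
      (\<forall>n::nat. n > r \<longrightarrow>
        (\<forall>\<theta>\<in>carrier_vec n. \<exists>\<theta>'\<in>carrier_vec n.
           polynomial_vector (r - 1) \<theta>' \<and>
           linf_norm (\<theta> - \<theta>') \<le> C * real n ^ (r - 1) * l1_norm (iterated_diff r \<theta>) \<and>
           C * real n ^ (r - 1) * l1_norm (iterated_diff r \<theta>) = C * variation r \<theta>))"
    \<comment> \<open>The constant is 1 for every \<open>r\<close>.\<close>
    by (intro exI[of _ 1]) auto
qed

end
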